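(* Let $m\in\mathbb N$, let $C\in\mathcal C_m$, and let $F\in\mathcal E_C$ be a proper exposed face of $C$. If $F$ strictly contains a proper exposed face $G\in\mathcal E_C$, then there exists a proper exposed face $F'\neq F$ of $C$ such that $G\subset F'$. Moreover, one can choose $F'$ to be a coatom of $\mathcal E_C$.
   Context: $\mathbb R^m$ carries the standard inner product $\langle\cdot,\cdot\rangle$. The relative interior of a convex set is its interior in its affine hull. For a convex set $C\subset\mathbb R^m$ the normal cone of $C$ at $x\in C$ is $N_C(x):=\{u\in\mathbb R^m\mid \forall y\in C:\ \langle u,y-x\rangle\le 0\}$. For a non-empty convex subset $F\subset C$, $N_C(F):=N_C(x)$ for any relative interior point $x$ of $F$ (well-defined), and $N_C(\emptyset):=\mathbb R^m$. $\mathcal N_C$ denotes the set of normal cones of $C$ at points of $C$ together with $N_C(\emptyset)=\mathbb R^m$. A proper normal cone of $C$ is an element of $\mathcal N_C$ other than $N_C(\emptyset)$ and $N_C(C)$. An exposed face of a convex set is either the empty set or the set of minimizers of a linear form on it (the zero form is allowed, so the whole set is an exposed face). $\mathcal E_C$ is the set of exposed faces of $C$ ordered by inclusion. A proper exposed face of $C$ is an $F\in\mathcal E_C$ with $F\ne\emptyset$ and $F\ne C$. A coatom of $\mathcal E_C$ is an inclusion-maximal element of $\mathcal E_C\setminus\{C\}$. A ray is a set $\{\alpha u\mid\alpha\ge0\}$ with $u\neq0$; an exposed ray of a convex cone is an exposed face of it which is a ray. Rays are linearly independent if vectors spanning them are. A proper convex subset of $\mathbb R^m$ is a convex subset of $\mathbb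 R^m$ with interior points which has a proper exposed face. $\mathcal C_m$ is the class of proper convex subsets $C$ of $\mathbb R^m$ such that every proper normal cone $N$ of $C$ has $\dim(N)$ linearly independent exposed rays which are in $\mathcal N_C$. *)

theory Defs
  imports "HOL-Analysis.Analysis"
begin

text \<open>Exposed faces are the library's \<^const>\<open>exposed_face_of\<close>, which is stated with supporting
  hyperplanes. On convex sets it coincides with being empty or the set of minimizers of a
  (possibly zero) linear form:\<close>

lemma exposed_face_of_iff_minimizers:
  fixes C F :: "'a::euclidean_space set"
  assumes "convex C"
  shows "F exposed_face_of C \<longleftrightarrow>
           F = {} \<or> (\<exists>c. F = {x \<in> C. \<forall>y\<in>C. c \<bullet> x \<le> c \<bullet> y})"
proof
  assume "F exposed_face_of C"
  then obtain a b where ab: "C \<subseteq> {x. a \<bullet> x \<le> b}" "F = C \<inter> {x. a \<bullet> x = b}"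
    unfolding exposed_face_of_def by blast
  show "F = {} \<or> (\<exists>c. F = {x \<in> C. \<forall>y\<in>C. c \<bullet> x \<le> c \<bullet> y})"
  proof (cases "F = {}")
    case False
    then obtain z where z: "z \<in> C" "a \<bullet> z = b" using ab by auto
    have "F = {x \<in> C. \<forall>y\<in>C. (- a) \<bullet> x \<le> (- a) \<bullet> y}"
    proof (intro equalityI subsetI)
      fix x assume "x \<in> F" then show "x \<in> {x \<in> C. \<forall>y\<in>C. (- a) \<bullet> x \<le> (- a) \<bullet> y}"
        using ab by auto
    next
      fix x assume "x \<in> {x \<in> C. \<forall>y\<in>C. (- a) \<bullet> x \<le> (- a) \<bullet> y}"
      then have "x \<in> C" "a \<bullet> z \<le> a \<bullet> x" using z by auto
      moreover have "a \<bullet> x \<le> b" using ab \<open>x \<in> C\<close> by auto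
      ultimately show "x \<in> F" using ab z by auto
    qed
    then show ?thesis by blast
  qed simp
next
  assume "F = {} \<or> (\<exists>c. F = {x \<in> C. \<forall>y\<in>C. c \<bullet> x \<le> c \<bullet> y})"
  then show "F exposed_face_of C"
  proof
    assume "\<exists>c. F = {x \<in> C. \<forall>y\<in>C. c \<bullet> x \<le> c \<bullet> y}"
    then obtain c where c: "F = {x \<in> C. \<forall>y\<in>C. c \<bullet> x \<le> c \<bullet> y}" by blast
    show ?thesis
    proof (cases "F = {}")
      case False
      then obtain z where z: "z \<in> C" "\<forall>y\<in>C. c \<bullet> z \<le> c \<bullet> y" using c by auto
      have eq: "F = C \<inter> {x. (- c) \<bullet> x = (- c) \<bullet> z}"
        using z c by (auto intro: antisym)
      have "C \<inter> {x. (- c) \<bullet> x = (- c) \<bullet> z} exposed_face_of C"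
        by (rule exposed_face_of_Int_supporting_hyperplane_le) (use assms z in auto)
      with eq show ?thesis by simp
    qed simp
  qed simp
qed

definition proper_exposed_face :: "'a::euclidean_space set \<Rightarrow> 'a set \<Rightarrow> bool" where
  "proper_exposed_face C F \<longleftrightarrow> F exposed_face_of C \<and> F \<noteq> {} \<and> F \<noteq> C"

definition exposed_face_coatom :: "'a::euclidean_space set \<Rightarrow> 'a set \<Rightarrow> bool" where
  "exposed_face_coatom C F \<longleftrightarrow> F exposed_face_of C \<and> F \<noteq> C \<and>
     (\<forall>H. H exposed_face_of C \<and> H \<noteq> C \<and> F \<subseteq> H \<longrightarrow> H = F)"

definition normal_cone_at :: "'a::euclidean_space set \<Rightarrow> 'a \<Rightarrow> 'a set" where
  "normal_cone_at C x = {u. \<forall>y\<in>C. u \<bullet> (y - x) \<le> 0}"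

definition normal_cone :: "'a::euclidean_space set \<Rightarrow> 'a set \<Rightarrow> 'a set" where
  "normal_cone C F =
     (if F = {} then UNIV else normal_cone_at C (SOME x. x \<in> rel_interior F))"

text \<open>The choice of the relative interior point does not matter.\<close>

lemma normal_cone_at_rel_interior_mono:
  assumes "F \<subseteq> C" "convex F" "x \<in> rel_interior F" "z \<in> F"
  shows "normal_cone_at C x \<subseteq> normal_cone_at C z"
proof
  fix u assume u: "u \<in> normal_cone_at C x"
  obtain e where e: "e > 1" "(1 - e) *\<^sub>R z + e *\<^sub>R x \<in> F"
    using convex_rel_interior_iff[of F x] assms by auto
  have "u \<bullet> ((1 - e) *\<^sub>R z + e *\<^sub>R x - x) \<le> 0"
    using u e assms(1) unfolding normal_cone_at_def by blast
  moreover have "(1 - e) *\<^sub>R z + e *\<^sub>R x - x = (e - 1) *\<^sub>R (x - z)"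
    by (simp add: algebra_simps)
  ultimately have "(e - 1) * (u \<bullet> (x - z)) \<le> 0" by simp
  then have le: "u \<bullet> (x - z) \<le> 0"
    using e(1) by (simp add: mult_le_0_iff)
  show "u \<in> normal_cone_at C z"
    unfolding normal_cone_at_def
  proof (intro CollectI ballI)
    fix y assume "y \<in> C"
    then have "u \<bullet> (y - x) \<le> 0" using u unfolding normal_cone_at_def by blast
    then show "u \<bullet> (y - z) \<le> 0" using le by (simp add: inner_diff_right)
  qed
qed

lemma normal_cone_eq:
  assumes "F \<subseteq> C" "convex F" "x \<in> rel_interior F"
  shows "normal_cone C F = normal_cone_at C x"
proof -
  have "(SOME x. x \<in> rel_interior F) \<in> rel_interior F" using assms(3) by (rule someI)
  then show ?thesis
    using assms normal_cone_at_rel_interior_mono[of F C] rel_interior_subset[of F]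
    unfolding normal_cone_def by (auto; blast)
qed

definition normal_cones :: "'a::euclidean_space set \<Rightarrow> 'a set set" where
  "normal_cones C = insert (normal_cone C {}) (normal_cone_at C ` C)"

definition proper_normal_cone :: "'a::euclidean_space set \<Rightarrow> 'a set \<Rightarrow> bool" where
  "proper_normal_cone C N \<longleftrightarrow>
     N \<in> normal_cones C \<and> N \<noteq> normal_cone C {} \<and> N \<noteq> normal_cone C C"

definition ray :: "'a::euclidean_space \<Rightarrow> 'a set" where
  "ray u = {\<alpha> *\<^sub>R u | \<alpha>. 0 \<le> \<alpha>}"

definition is_ray :: "'a::euclidean_space set \<Rightarrow> bool" where
  "is_ray R \<longleftrightarrow> (\<exists>u. u \<noteq> 0 \<and> R = ray u)"

definition exposed_ray_of :: "'a::euclidean_space set \<Rightarrow> 'a set \<Rightarrow> bool" where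
  "exposed_ray_of R N \<longleftrightarrow> is_ray R \<and> R exposed_face_of N"

text \<open>Independent vectors are nonzero and span pairwise distinct rays, so the set \<open>U\<close> below
  contains exactly one spanning vector of each ray.\<close>

definition independent_rays :: "'a::euclidean_space set set \<Rightarrow> bool" where
  "independent_rays \<R> \<longleftrightarrow> (\<exists>U. independent U \<and> \<R> = ray ` U)"

definition proper_convex :: "'a::euclidean_space set \<Rightarrow> bool" where
  "proper_convex C \<longleftrightarrow> convex C \<and> interior C \<noteq> {} \<and> (\<exists>F. proper_exposed_face C F)"

text \<open>The dimension of a convex set is that of its affine hull, \<^const>\<open>aff_dim\<close>.\<close>

definition ray_generated_class :: "'a::euclidean_space set set" where
  "ray_generated_class = {C. proper_convex C \<and>
     (\<forall>N. proper_normal_cone C N \<longrightarrow>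
        (\<exists>\<R>. \<R> \<subseteq> normal_cones C \<and> (\<forall>R\<in>\<R>. exposed_ray_of R N) \<and>
              independent_rays \<R> \<and> int (card \<R>) = aff_dim N))}"

end

theory Submission
  imports Defs
begin

text \<open>A ray that is a normal cone yields a coatom. If \<open>N\<^sub>C(y)\<close> is the ray of \<open>v\<close>, then
  every exposed face \<open>H \<noteq> C\<close> through \<open>y\<close> is exposed by a non-zero vector of \<open>N\<^sub>C(y)\<close>, that
  is, by a positive multiple of \<open>v\<close>. Hence \<open>H\<close> is the face \<open>F\<^sub>v\<close> exposed by \<open>v\<close>, which is
  therefore maximal (\<open>normal_ray_exposes_coatom\<close>). The same argument shows that distinct normal
  cones that are rays expose distinct coatoms (\<open>normal_rays_eq_if_faces_eq\<close>).

  It remains to find two such rays in the normal cone of \<open>G\<close>, for then at least one of the two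
  coatoms, both of which contain \<open>G\<close>, differs from \<open>F\<close>. This cone contains
  a vector exposing \<open>F\<close> and one exposing \<open>G\<close>. They are not positive multiples of each
  other since \<open>F \<noteq> G\<close>, and not negative multiples since \<open>C\<close> has interior points. So they
  are linearly independent, the cone has dimension at least two
  (\<open>two_le_aff_dim_normal_cone\<close>), and the assumption on \<open>C\<close> provides the two rays.\<close>

section \<open>Faces exposed by a vector\<close>

definition face_exposed_by :: "'a::euclidean_space set \<Rightarrow> 'a \<Rightarrow> 'a set" where
  "face_exposed_by C u = {x \<in> C. \<forall>y\<in>C. u \<bullet> y \<le> u \<bullet> x}"

lemma mem_face_exposed_by_iff:
  "x \<in> face_exposed_by C u \<longleftrightarrow> x \<in> C \<and> u \<in> normal_cone_at C x"
  by (auto simp: face_exposed_by_def normal_cone_at_def inner_diff_right)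

lemma face_exposed_by_scaleR:
  assumes "0 < \<alpha>"
  shows "face_exposed_by C (\<alpha> *\<^sub>R u) = face_exposed_by C u"
  using assms by (auto simp: face_exposed_by_def)

lemma exposed_face_of_face_exposed_by:
  assumes "convex C"
  shows "face_exposed_by C u exposed_face_of C"
proof -
  have "face_exposed_by C u = {x \<in> C. \<forall>y\<in>C. (- u) \<bullet> x \<le> (- u) \<bullet> y}"
    by (simp add: face_exposed_by_def)
  then show ?thesis
    unfolding exposed_face_of_iff_minimizers[OF assms] by blast
qed

lemma exposed_face_obtain_normal:
  assumes "convex C" "F exposed_face_of C" "F \<noteq> {}" "F \<noteq> C"
  obtains u where "u \<noteq> 0" "F = face_exposed_by C u"
proof -
  obtain c where c: "F = {x \<in> C. \<forall>y\<in>C. c \<bullet> x \<le> c \<bullet> y}"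
    using exposed_face_of_iff_minimizers[OF assms(1)] assms(2,3) by auto
  then have "F = face_exposed_by C (- c)"
    by (simp add: face_exposed_by_def)
  moreover have "- c \<noteq> 0"
    using c \<open>F \<noteq> C\<close> by auto
  ultimately show thesis
    using that by blast
qed

text \<open>Moving from an interior point along \<open>u\<close> stays in \<open>C\<close> for a while and increases the
  linear form.\<close>

lemma interior_point_notin_face_exposed_by:
  assumes "z \<in> interior C" "u \<noteq> 0"
  shows "z \<notin> face_exposed_by C u"
proof
  assume z: "z \<in> face_exposed_by C u"
  obtain e where e: "e > 0" "cball z e \<subseteq> C"
    using assms(1) mem_interior_cball by metis
  have "z + (e / norm u) *\<^sub>R u \<in> C"
    using e assms(2) by (intro subsetD[OF e(2)]) (simp add: dist_norm)
  then have "u \<bullet> (z + (e / norm u) *\<^sub>R u) \<le> u \<bullet> z"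
    using z by (auto simp: face_exposed_by_def)
  moreover have "(e / norm u) * (u \<bullet> u) > 0"
    using e assms(2) by simp
  ultimately show False
    by (simp add: inner_add_right)
qed

lemma proper_exposed_face_face_exposed_by:
  assumes "convex C" "interior C \<noteq> {}" "u \<noteq> 0" "face_exposed_by C u \<noteq> {}"
  shows "proper_exposed_face C (face_exposed_by C u)"
proof -
  obtain z where "z \<in> interior C"
    using assms(2) by blast
  then have "face_exposed_by C u \<noteq> C"
    using interior_point_notin_face_exposed_by[OF _ assms(3)] interior_subset by blast
  then show ?thesis
    using assms exposed_face_of_face_exposed_by by (auto simp: proper_exposed_face_def)
qed

section \<open>Pointedness and dimension of normal cones\<close>

text \<open>The normal cones of a convex set with interior points are pointed: if a linear form and its
  negative both attained their maximum over \<open>C\<close> at \<open>x\<close>, the form would be constant on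
  \<open>C\<close>, and a non-zero form has no maximizer in the interior.\<close>

lemma normal_cone_at_pointed:
  assumes "interior C \<noteq> {}" "x \<in> C" "u \<in> normal_cone_at C x" "- u \<in> normal_cone_at C x"
  shows "u = 0"
proof (rule ccontr)
  assume u: "u \<noteq> 0"
  obtain z where z: "z \<in> interior C"
    using assms(1) by blast
  have const: "u \<bullet> y = u \<bullet> x" if "y \<in> C" for y
    using assms(3,4) that
    by (fastforce simp: normal_cone_at_def inner_diff_right)
  have "z \<in> face_exposed_by C u"
    using z const interior_subset by (fastforce simp: face_exposed_by_def)
  then show False
    using interior_point_notin_face_exposed_by[OF z u] by blast
qed

lemma zero_mem_normal_cone_at: "0 \<in> normal_cone_at C x"
  by (simp add: normal_cone_at_def)

lemma exposing_vectors_independent: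
  assumes "interior C \<noteq> {}" "x \<in> C" "u \<in> normal_cone_at C x" "v \<in> normal_cone_at C x"
    and "u \<noteq> 0" "v \<noteq> 0" "face_exposed_by C u \<noteq> face_exposed_by C v"
  shows "independent {u, v}"
proof -
  have "u \<noteq> k *\<^sub>R v" for k
  proof
    assume uk: "u = k *\<^sub>R v"
    show False
    proof (cases "0 < k")
      case True
      then show False
        using uk assms(7) face_exposed_by_scaleR by metis
    next
      case False
      have "- u \<in> normal_cone_at C x"
        using assms(4) False unfolding uk normal_cone_at_def
        by (auto simp: mult_nonpos_nonpos)
      then show False
        using normal_cone_at_pointed assms(1-3,5) by blast
    qed
  qed
  then have "u \<notin> span {v}"
    by (auto simp: span_singleton)
  then show ?thesis
    using assms(6) by (simp add: independent_insert)
qed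

lemma two_le_aff_dim_normal_cone:
  assumes "interior C \<noteq> {}" "x \<in> C" "u \<in> normal_cone_at C x" "v \<in> normal_cone_at C x"
    and "u \<noteq> 0" "v \<noteq> 0" "face_exposed_by C u \<noteq> face_exposed_by C v"
  shows "2 \<le> aff_dim (normal_cone_at C x)"
proof -
  have "card {u, v} \<le> dim (normal_cone_at C x)"
    using exposing_vectors_independent[OF assms] assms(3,4)
    by (intro independent_card_le_dim) auto
  moreover have "u \<noteq> v"
    using assms(7) by auto
  moreover have "aff_dim (normal_cone_at C x) = int (dim (normal_cone_at C x))"
    using zero_mem_normal_cone_at by (intro aff_dim_zero hull_inc)
  ultimately show ?thesis
    by simp
qed

section \<open>Normal cones that are rays\<close>

lemma ray_scaleR:
  assumes "0 < \<alpha>"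
  shows "ray (\<alpha> *\<^sub>R v) = ray v"
proof -
  have "\<exists>\<gamma>. \<beta> *\<^sub>R v = \<gamma> *\<^sub>R \<alpha> *\<^sub>R v \<and> 0 \<le> \<gamma>" if "0 \<le> \<beta>" for \<beta>
    using assms that by (intro exI[of _ "\<beta> / \<alpha>"]) simp
  moreover have "\<exists>\<gamma>. \<beta> *\<^sub>R \<alpha> *\<^sub>R v = \<gamma> *\<^sub>R v \<and> 0 \<le> \<gamma>" if "0 \<le> \<beta>" for \<beta>
    using assms that by (intro exI[of _ "\<beta> * \<alpha>"]) simp
  ultimately show ?thesis
    unfolding ray_def by blast
qed

lemma mem_ray_nonzeroE:
  assumes "w \<in> ray v" "w \<noteq> 0"
  obtains \<alpha> where "0 < \<alpha>" "w = \<alpha> *\<^sub>R v"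
  using assms by (auto simp: ray_def less_le)

lemma self_mem_ray: "v \<in> ray v"
  unfolding ray_def by (intro CollectI exI[of _ 1]) simp

lemma ray_neq_UNIV:
  assumes "v \<noteq> 0"
  shows "ray v \<noteq> UNIV"
proof
  assume "ray v = UNIV"
  then obtain \<alpha> where \<alpha>: "0 \<le> \<alpha>" "- v = \<alpha> *\<^sub>R v"
    unfolding ray_def by blast
  then have "(1 + \<alpha>) *\<^sub>R v = 0"
    by (simp add: scaleR_add_left flip: \<alpha>(2))
  then show False
    using assms \<alpha>(1) by simp
qed

text \<open>The cone \<open>N\<^sub>C(\<emptyset>)\<close> is the whole space and thus not a ray.\<close>

lemma normal_ray_obtain_point:
  assumes "ray v \<in> normal_cones C" "v \<noteq> 0"
  obtains y where "y \<in> face_exposed_by C v" "normal_cone_at C y = ray v"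
  using assms ray_neq_UNIV[of v] self_mem_ray[of v]
  by (auto simp: normal_cones_def normal_cone_def mem_face_exposed_by_iff)

lemma normal_ray_exposes_coatom:
  assumes "convex C" "interior C \<noteq> {}" "v \<noteq> 0" "ray v \<in> normal_cones C"
  shows "exposed_face_coatom C (face_exposed_by C v)"
  unfolding exposed_face_coatom_def
proof (intro conjI allI impI)
  obtain y where y: "y \<in> face_exposed_by C v" "normal_cone_at C y = ray v"
    using normal_ray_obtain_point assms(3,4) by metis
  then have "proper_exposed_face C (face_exposed_by C v)"
    using proper_exposed_face_face_exposed_by assms(1-3) by blast
  then show "face_exposed_by C v exposed_face_of C" "face_exposed_by C v \<noteq> C"
    by (simp_all add: proper_exposed_face_def)
  fix H assume H: "H exposed_face_of C \<and> H \<noteq> C \<and> face_exposed_by C v \<subseteq> H"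
  then obtain w where w: "w \<noteq> 0" "H = face_exposed_by C w"
    using exposed_face_obtain_normal[OF assms(1), of H] y(1) by blast
  then have "w \<in> ray v"
    using H y mem_face_exposed_by_iff by blast
  then obtain \<alpha> where "0 < \<alpha>" "w = \<alpha> *\<^sub>R v"
    using w(1) mem_ray_nonzeroE by blast
  then show "H = face_exposed_by C v"
    using w(2) by (simp add: face_exposed_by_scaleR)
qed

lemma normal_rays_eq_if_faces_eq:
  assumes "ray v \<in> normal_cones C" "v \<noteq> 0" "w \<noteq> 0"
    and "face_exposed_by C v = face_exposed_by C w"
  shows "ray v = ray w"
proof -
  obtain y where "y \<in> face_exposed_by C v" "normal_cone_at C y = ray v"
    using normal_ray_obtain_point assms(1,2) by metis
  then have "w \<in> ray v"
    using assms(4) mem_face_exposed_by_iff by blast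
  then obtain \<alpha> where "0 < \<alpha>" "w = \<alpha> *\<^sub>R v"
    using assms(3) mem_ray_nonzeroE by blast
  then show ?thesis
    by (simp add: ray_scaleR)
qed

section \<open>A second coatom above a face\<close>

text \<open>At a relative interior point of \<open>G\<close> the normal cone is \<open>N\<^sub>C(G)\<close>, so its vectors expose
  faces that contain all of \<open>G\<close>, not only \<open>x\<close>.\<close>

lemma subset_face_exposed_by:
  assumes "G \<subseteq> C" "convex G" "x \<in> rel_interior G" "v \<in> normal_cone_at C x"
  shows "G \<subseteq> face_exposed_by C v"
  using assms normal_cone_at_rel_interior_mono[of G C x] mem_face_exposed_by_iff by blast

text \<open>\<open>N\<^sub>C(C)\<close> is the normal cone at an interior point, hence zero, and \<open>N\<^sub>C(\<emptyset>)\<close> is the whole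
  space, hence not pointed.\<close>

lemma proper_normal_cone_normal_cone_at:
  assumes "convex C" "interior C \<noteq> {}" "x \<in> C" "u \<in> normal_cone_at C x" "u \<noteq> 0"
  shows "proper_normal_cone C (normal_cone_at C x)"
  unfolding proper_normal_cone_def
proof (intro conjI)
  show "normal_cone_at C x \<in> normal_cones C"
    using assms(3) by (simp add: normal_cones_def)
  show "normal_cone_at C x \<noteq> normal_cone C {}"
    using normal_cone_at_pointed[OF assms(2,3,4)] assms(5) by (auto simp: normal_cone_def)
  obtain z where z: "z \<in> interior C"
    using assms(2) by blast
  then have "normal_cone C C = normal_cone_at C z"
    using normal_cone_eq[of C C z] assms(1) interior_subset_rel_interior by blast
  moreover have "u \<notin> normal_cone_at C z"
    using interior_point_notin_face_exposed_by[OF z assms(5)] z interior_subset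
      mem_face_exposed_by_iff by blast
  ultimately show "normal_cone_at C x \<noteq> normal_cone C C"
    using assms(4) by blast
qed

theorem corollary2p4:
  fixes C F G :: "(real ^ 'm) set"
  assumes "C \<in> ray_generated_class"
    and "proper_exposed_face C F"
    and "proper_exposed_face C G"
    and "G \<subset> F"
  shows "(\<exists>F'. proper_exposed_face C F' \<and> F' \<noteq> F \<and> G \<subseteq> F') \<and>
         (\<exists>F'. proper_exposed_face C F' \<and> F' \<noteq> F \<and> G \<subseteq> F' \<and> exposed_face_coatom C F')"
proof -
  have C: "convex C" "interior C \<noteq> {}"
    using assms(1) by (simp_all add: ray_generated_class_def proper_convex_def)
  obtain u where u: "u \<noteq> 0" "F = face_exposed_by C u"
    using exposed_face_obtain_normal[OF C(1)] assms(2) proper_exposed_face_def by metis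
  obtain v where v: "v \<noteq> 0" "G = face_exposed_by C v"
    using exposed_face_obtain_normal[OF C(1)] assms(3) proper_exposed_face_def by metis
  have G: "convex G" "G \<subseteq> C" "G \<noteq> {}"
    using assms(3)
    by (auto simp: proper_exposed_face_def exposed_face_of_def
        dest: face_of_imp_convex face_of_imp_subset)
  then obtain x where x: "x \<in> rel_interior G"
    using rel_interior_eq_empty by blast
  then have xG: "x \<in> G" and xC: "x \<in> C"
    using rel_interior_subset G by blast+
  have uN: "u \<in> normal_cone_at C x" and vN: "v \<in> normal_cone_at C x"
    using xG assms(4) mem_face_exposed_by_iff u(2) v(2) by blast+

  have "proper_normal_cone C (normal_cone_at C x)"
    using proper_normal_cone_normal_cone_at C xC vN v(1) by blast
  then obtain \<R> where \<R>: "\<R> \<subseteq> normal_cones C"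
      "\<forall>R\<in>\<R>. exposed_ray_of R (normal_cone_at C x)"
      "int (card \<R>) = aff_dim (normal_cone_at C x)"
    using assms(1) unfolding ray_generated_class_def by blast
  have "2 \<le> aff_dim (normal_cone_at C x)"
    using two_le_aff_dim_normal_cone[OF C(2) xC uN vN u(1) v(1)] assms(4) u(2) v(2) by blast
  then have "\<not> card \<R> \<le> Suc 0"
    using \<R>(3) by linarith
  \<comment> \<open>The bound on \<open>card\<close> also gives finiteness, since an infinite set has cardinality 0.\<close>
  then obtain R S where RS: "R \<in> \<R>" "S \<in> \<R>" "R \<noteq> S"
    using card_le_Suc0_iff_eq[of \<R>] by (metis card.infinite le0)
  have spanning: "\<exists>a. a \<noteq> 0 \<and> T = ray a" if "T \<in> \<R>" for T
    using \<R>(2) that by (auto simp: exposed_ray_of_def is_ray_def)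
  obtain a where a: "a \<noteq> 0" "R = ray a"
    using spanning RS(1) by blast
  obtain b where b: "b \<noteq> 0" "S = ray b"
    using spanning RS(2) by blast

  have face: "proper_exposed_face C (face_exposed_by C c) \<and> G \<subseteq> face_exposed_by C c \<and>
      exposed_face_coatom C (face_exposed_by C c)" if "c \<noteq> 0" "ray c \<in> \<R>" for c
  proof -
    have "ray c \<subseteq> normal_cone_at C x"
      using \<R>(2) that(2)
      by (auto simp: exposed_ray_of_def exposed_face_of_def dest: face_of_imp_subset)
    then have "G \<subseteq> face_exposed_by C c"
      using subset_face_exposed_by G(1,2) x self_mem_ray by blast
    then show ?thesis
      using proper_exposed_face_face_exposed_by[OF C that(1)] G(3)
        normal_ray_exposes_coatom[OF C that(1)] \<R>(1) that(2) by blast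
  qed
  have "face_exposed_by C a \<noteq> face_exposed_by C b"
    using normal_rays_eq_if_faces_eq[of a C b] a b RS \<R>(1) by blast
  then show ?thesis
    using face[of a] face[of b] a b RS by metis
qed

end
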